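(* Let $T$ be a left-invertible bounded linear operator on a complex separable Hilbert space $\mathcal H$ and let $T' = T(T^*T)^{-1}$ denote the Cauchy dual of $T$. Suppose that $T$ has the wandering subspace property. For each $w \in \mathbb C$ and $n \in \mathbb N$, set $$\mathcal M_n := \bigvee_{k=0}^n T^k(\ker T^* ) \quad \text{and} \quad S_n(w) := \sum_{k=0}^n \overline{w}^k T'^k.$$ Then $w \in bpe(T)$ if and only if $\sup_{n \in \mathbb N}\|P_{\mathcal M_n} S_n(w)|_{\ker T^*}\| < \infty$. Moreover, if $w \in bpe(T)$, then $\|E_w^*\| = \sup_{n \in \mathbb N}\|P_{\mathcal M_n} S_n(w)|_{\ker T^*}\|$.
   Context: $\mathbb N$ denotes the non-negative integers; $\bigvee$ denotes closed linear span; $P_{\mathcal M}$ is the orthogonal projection of $\mathcal H$ onto a closed subspace $\mathcal M$. If $T$ is left-invertible then $T^*T$ is invertible, so $T'$ is well defined. A bounded operator $T$ on $\mathcal H$ has the wandering subspace property if $\bigvee_{n \in \mathbb N} T^n(\ker T^* ) = \mathcal H$. $\mathcal P(\mathbb C, \ker T^* )$ is the vector space of all $\ker T^*$-valued polynomials $p(z) = \sum_{n=0}^k x_n z^n$, $x_n \in \ker T^*$, and for such $p$ one sets $p(T) := \sum_{n=0}^k T^n x_n \in \mathcal H$. For $T$ with the wandering subspace property, $bpe(T)$ is the set of all $w \in \mathbb C$ (the bounded point evaluations for $T$) for which there is a constant $c>0$ such that $\|p(w)\| \leqslant c\,\|p(T)\|$ for all $p \in \mathcal P(\mathbb C, \ker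 T^* )$. For $w \in bpe(T)$, $E_w : \mathcal H \to \ker T^*$ is the unique bounded linear operator with $E_w(p(T)) = p(w)$ for all $p \in \mathcal P(\mathbb C, \ker T^* )$, and $E_w^* : \ker T^* \to \mathcal H$ is its adjoint. *)

theory Defs
  imports "HOL-Analysis.Analysis" "HOL-Computational_Algebra.Polynomial"
begin

section \<open>Complex Hilbert spaces\<close>

class complex_vector = real_vector +
  fixes scaleC :: "complex \<Rightarrow> 'a \<Rightarrow> 'a" (infixr \<open>*\<^sub>C\<close> 75)
  assumes scaleC_add_right: "a *\<^sub>C (x + y) = a *\<^sub>C x + a *\<^sub>C y"
    and scaleC_add_left: "(a + b) *\<^sub>C x = a *\<^sub>C x + b *\<^sub>C x"
    and scaleC_scaleC: "a *\<^sub>C (b *\<^sub>C x) = (a * b) *\<^sub>C x"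
    and scaleR_eq_scaleC: "r *\<^sub>R x = complex_of_real r *\<^sub>C x"

global_interpretation complex_vector: vector_space "scaleC :: complex \<Rightarrow> 'a \<Rightarrow> 'a::complex_vector"
  defines cspan = "complex_vector.span"
proof
  show "1 *\<^sub>C x = x" for x :: 'a
    using scaleR_eq_scaleC[of 1 x] by simp
qed (simp_all add: scaleC_add_right scaleC_add_left scaleC_scaleC)

text \<open>
  The scalar product \<open>cinner\<close> is linear in its first argument. The real inner product
  inherited from \<open>real_inner\<close> is its real part, so that the inherited norm
  satisfies \<open>norm x = sqrt (Re (cinner x x))\<close>, where \<open>cinner x x\<close> is real by
  \<open>cinner_commute\<close>.
\<close>

class complex_inner = complex_vector + real_inner +
  fixes cinner :: "'a \<Rightarrow> 'a \<Rightarrow> complex"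
  assumes cinner_commute: "cinner x y = cnj (cinner y x)"
    and cinner_add_left: "cinner (x + y) z = cinner x z + cinner y z"
    and cinner_scaleC_left: "cinner (a *\<^sub>C x) y = a * cinner x y"
    and inner_eq_Re_cinner: "inner x y = Re (cinner x y)"

class chilbert_space = complex_inner + complete_space
begin
subclass banach ..
end

instantiation complex :: chilbert_space
begin
definition scaleC_complex :: "complex \<Rightarrow> complex \<Rightarrow> complex"
  where "scaleC_complex a x = a * x"
definition cinner_complex :: "complex \<Rightarrow> complex \<Rightarrow> complex"
  where "cinner_complex x y = x * cnj y"
instance
  by standard
    (auto simp: scaleC_complex_def cinner_complex_def inner_complex_def algebra_simps scaleR_conv_of_real)
end

section \<open>Operators\<close>

definition bounded_clinear :: "('a::complex_inner \<Rightarrow> 'b::complex_inner) \<Rightarrow> bool"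
  where "bounded_clinear A \<longleftrightarrow> bounded_linear A \<and> (\<forall>c x. A (c *\<^sub>C x) = c *\<^sub>C A x)"

definition closed_cspan :: "'a::complex_inner set \<Rightarrow> 'a set"
  where "closed_cspan S = closure (cspan S)"

text \<open>
  If \<open>A\<close> takes its values in a closed subspace \<open>K\<close>, then the adjoint of \<open>A\<close>, regarded as
  an operator into \<open>K\<close>, is the restriction of \<open>cadjoint A\<close> to \<open>K\<close>.
\<close>

definition cadjoint :: "('a::chilbert_space \<Rightarrow> 'b::chilbert_space) \<Rightarrow> 'b \<Rightarrow> 'a"
  where "cadjoint A y = (THE z. \<forall>x. cinner (A x) y = cinner x z)"

definition cproj :: "'a::chilbert_space set \<Rightarrow> 'a \<Rightarrow> 'a"
  where "cproj M x = (THE y. y \<in> M \<and> (\<forall>z\<in>M. cinner (x - y) z = 0))"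

text \<open>
  The operator norm of the restriction of \<open>A\<close> to a subspace \<open>K\<close>, in analogy to \<open>onorm\<close>;
  the junk value \<open>0 / 0 = 0\<close> contributed by the zero vector does not affect the supremum
  and gives norm \<open>0\<close> in case \<open>K = {0}\<close>.
\<close>

definition onorm_on :: "'a::real_normed_vector set \<Rightarrow> ('a \<Rightarrow> 'b::real_normed_vector) \<Rightarrow> real"
  where "onorm_on K A = (SUP x\<in>K. norm (A x) / norm x)"

definition left_invertible :: "('a::chilbert_space \<Rightarrow> 'a) \<Rightarrow> bool"
  where "left_invertible T \<longleftrightarrow> (\<exists>L. bounded_clinear L \<and> (\<forall>x. L (T x) = x))"

definition ker_adj :: "('a::chilbert_space \<Rightarrow> 'a) \<Rightarrow> 'a set"
  where "ker_adj T = {x. cadjoint T x = 0}"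

definition cauchy_dual :: "('a::chilbert_space \<Rightarrow> 'a) \<Rightarrow> 'a \<Rightarrow> 'a"
  where "cauchy_dual T = T \<circ> inv (cadjoint T \<circ> T)"

definition wandering_subspace_property :: "('a::chilbert_space \<Rightarrow> 'a) \<Rightarrow> bool"
  where "wandering_subspace_property T \<longleftrightarrow>
    closed_cspan (\<Union>n. (T ^^ n) ` ker_adj T) = UNIV"

section \<open>Bounded point evaluations\<close>

text \<open>
  A vector-valued polynomial is represented by its coefficient sequence, i.e. an element
  of \<open>'a poly\<close>; the library function \<open>poly\<close> does not apply, as \<open>'a\<close> is not a ring.
\<close>

definition ker_polys :: "('a::chilbert_space \<Rightarrow> 'a) \<Rightarrow> 'a poly set"
  where "ker_polys T = {p. \<forall>n. coeff p n \<in> ker_adj T}"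

definition vpoly :: "'a::chilbert_space poly \<Rightarrow> complex \<Rightarrow> 'a"
  where "vpoly p w = (\<Sum>n\<le>degree p. w ^ n *\<^sub>C coeff p n)"

definition vpoly_op :: "'a::chilbert_space poly \<Rightarrow> ('a \<Rightarrow> 'a) \<Rightarrow> 'a"
  where "vpoly_op p T = (\<Sum>n\<le>degree p. (T ^^ n) (coeff p n))"

definition bpe :: "('a::chilbert_space \<Rightarrow> 'a) \<Rightarrow> complex set"
  where "bpe T = {w. \<exists>c>0. \<forall>p\<in>ker_polys T. norm (vpoly p w) \<le> c * norm (vpoly_op p T)}"

definition eval_op :: "('a::chilbert_space \<Rightarrow> 'a) \<Rightarrow> complex \<Rightarrow> 'a \<Rightarrow> 'a"
  where "eval_op T w = (THE E. bounded_clinear E \<and> range E \<subseteq> ker_adj T \<and>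
    (\<forall>p\<in>ker_polys T. E (vpoly_op p T) = vpoly p w))"

definition wand_space :: "('a::chilbert_space \<Rightarrow> 'a) \<Rightarrow> nat \<Rightarrow> 'a set"
  where "wand_space T n = closed_cspan (\<Union>k\<le>n. (T ^^ k) ` ker_adj T)"

definition dual_sum :: "('a::chilbert_space \<Rightarrow> 'a) \<Rightarrow> nat \<Rightarrow> complex \<Rightarrow> 'a \<Rightarrow> 'a"
  where "dual_sum T n w x = (\<Sum>k\<le>n. cnj w ^ k *\<^sub>C (cauchy_dual T ^^ k) x)"

end

theory Submission
  imports Defs
begin

text \<open>
  The key is that \<open>S\<^sub>n(w)\<close> acts as a truncated reproducing kernel. Since \<open>T'\<^sup>* T = I\<close> and
  both \<open>T\<^sup>*\<close> and \<open>T'\<^sup>*\<close> vanish on \<open>ker T\<^sup>*\<close>, the vectors \<open>T\<^sup>j x\<close> and \<open>T'\<^sup>k y\<close> with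
  \<open>x, y\<close> in \<open>ker T\<^sup>*\<close> are orthogonal for \<open>j \<noteq> k\<close> and have scalar product
  \<open>\<langle>x, y\<rangle>\<close> for \<open>j = k\<close> (lemma \<open>cinner_funpow_cauchy_dual_funpow\<close>). Hence
  \<open>\<langle>p(T), S\<^sub>n(w) y\<rangle> = \<langle>p(w), y\<rangle>\<close> for every polynomial \<open>p\<close> of degree at most \<open>n\<close>, and as
  \<open>p(T)\<close> lies in \<open>M\<^sub>n\<close>, the vector \<open>S\<^sub>n(w) y\<close> may be replaced by its projection
  \<open>A\<^sub>n y\<close> onto \<open>M\<^sub>n\<close> (lemma \<open>cinner_vpoly_op_cproj_dual_sum\<close>).

  If the norms of all \<open>A\<^sub>n\<close> are at most \<open>C\<close>, then taking \<open>y = p(w)\<close> gives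
  \<open>\<parallel>p(w)\<parallel>\<^sup>2 \<le> \<parallel>p(T)\<parallel> C \<parallel>p(w)\<parallel>\<close>, so \<open>C\<close> is a constant of the point evaluation at \<open>w\<close>.
  Conversely, if \<open>w\<close> is a bounded point evaluation, then \<open>E\<^sub>w\<^sup>* y\<close> satisfies the same identity
  as \<open>A\<^sub>n y\<close>. The vectors \<open>p(T)\<close> with \<open>p\<close> of degree at most \<open>n\<close> are dense in \<open>M\<^sub>n\<close>,
  so \<open>A\<^sub>n y\<close> is the projection of \<open>E\<^sub>w\<^sup>* y\<close> onto \<open>M\<^sub>n\<close> and its norm is at most that of
  \<open>E\<^sub>w\<^sup>* y\<close>. Finally, all \<open>p(T)\<close> together are dense by the wandering subspace property, so
  \<open>\<parallel>E\<^sub>w\<^sup>* y\<parallel>\<close> is the least \<open>c\<close> with \<open>|\<langle>p(w), y\<rangle>| \<le> c \<parallel>p(T)\<parallel>\<close> for all \<open>p\<close>; the first step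
  bounds it by \<open>C \<parallel>y\<parallel>\<close>, which yields the norm formula.

  Behind this stand the projection theorem, the Riesz theorem and hence adjoints on a
  complex Hilbert space, the surjectivity of \<open>T\<^sup>* T\<close>, and the existence of \<open>E\<^sub>w\<close> by
  extension from a dense subspace (lemmas \<open>orthogonal_projection_exists\<close>,
  \<open>Riesz_representation\<close>, \<open>surj_cadjoint_comp_if_left_invertible\<close>,
  \<open>bounded_clinear_extension_of_graph\<close>).
\<close>

section \<open>Complex inner product spaces\<close>

lemma cinner_add_right: "cinner x (y + z) = cinner x y + cinner (x::'a::complex_inner) z"
  by (metis cinner_add_left cinner_commute complex_cnj_add)

lemma cinner_scaleC_right: "cinner x (a *\<^sub>C y) = cnj a * cinner (x::'a::complex_inner) y"
  by (metis cinner_commute cinner_scaleC_left complex_cnj_mult)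

lemma cinner_self: "cinner x x = complex_of_real ((norm (x::'a::complex_inner))\<^sup>2)"
proof -
  have "Im (cinner x x) = 0"
    by (metis cinner_commute Reals_cnj_iff complex_is_Real_iff)
  then show ?thesis
    by (simp add: complex_eq_iff power2_norm_eq_inner inner_eq_Re_cinner)
qed

lemma cmod_cinner_self: "cmod (cinner x x) = norm x * norm (x::'a::complex_inner)"
  by (simp add: cinner_self norm_mult power2_eq_square)

lemma norm_scaleC: "norm (a *\<^sub>C x) = cmod a * norm (x::'a::complex_inner)"
proof -
  have "complex_of_real ((norm (a *\<^sub>C x))\<^sup>2) = complex_of_real ((cmod a * norm x)\<^sup>2)"
    unfolding cinner_self[symmetric] cinner_scaleC_left cinner_scaleC_right
    by (simp add: cinner_self power_mult_distrib complex_norm_square[of a] mult.assoc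
        flip: of_real_power)
  then show ?thesis
    by (metis of_real_eq_iff norm_ge_zero power2_eq_imp_eq mult_nonneg_nonneg)
qed

text \<open>Multiplying \<open>x\<close> by a suitable number of modulus one makes \<open>cinner x y\<close> real and
  nonnegative, which reduces the estimate to the real Cauchy-Schwarz inequality.\<close>

lemma cmod_cinner_le: "cmod (cinner x y) \<le> norm x * norm (y::'a::complex_inner)"
proof (cases "cinner x y = 0")
  case False
  define a where "a = cnj (sgn (cinner x y))"
  have a: "cmod a = 1"
    using False by (simp add: a_def norm_sgn)
  have "a * cinner x y = complex_of_real (cmod (cinner x y))"
    using False
    by (simp add: a_def sgn_eq complex_norm_square[symmetric] mult.commute power2_eq_square)
  then have "cmod (cinner x y) = inner (a *\<^sub>C x) y"
    by (simp add: inner_eq_Re_cinner cinner_scaleC_left)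
  also have "\<dots> \<le> norm (a *\<^sub>C x) * norm y"
    by (rule norm_cauchy_schwarz)
  finally show ?thesis
    by (simp add: norm_scaleC a)
qed simp

lemma bounded_bilinear_cinner:
  "bounded_bilinear (cinner :: 'a::complex_inner \<Rightarrow> 'a \<Rightarrow> complex)"
proof
  show "\<exists>K. \<forall>a b :: 'a. norm (cinner a b) \<le> norm a * norm b * K"
    by (rule exI[of _ 1]) (simp add: cmod_cinner_le)
qed (simp_all add: cinner_add_left cinner_add_right scaleR_eq_scaleC[where 'a='a]
      cinner_scaleC_left cinner_scaleC_right scaleR_conv_of_real)

interpretation cinner: bounded_bilinear "cinner :: 'a::complex_inner \<Rightarrow> 'a \<Rightarrow> complex"
  by (rule bounded_bilinear_cinner)

lemma bounded_bilinear_scaleC: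
  "bounded_bilinear (scaleC :: complex \<Rightarrow> 'a::complex_inner \<Rightarrow> 'a)"
proof
  show "\<exists>K. \<forall>a (b :: 'a). norm (a *\<^sub>C b) \<le> norm a * norm b * K"
    by (rule exI[of _ 1]) (simp add: norm_scaleC)
qed (simp_all add: scaleC_add_right scaleC_add_left scaleR_eq_scaleC[where 'a='a]
      scaleR_conv_of_real scaleC_scaleC mult.commute)

interpretation scaleC: bounded_bilinear "scaleC :: complex \<Rightarrow> 'a::complex_inner \<Rightarrow> 'a"
  by (rule bounded_bilinear_scaleC)

lemma cinner_eq_right_imp_eq:
  assumes "\<And>x. cinner x y = cinner x (z::'a::complex_inner)"
  shows "y = z"
proof -
  have "cinner (y - z) (y - z) = 0"
    using assms by (simp add: cinner.diff_right)
  then show ?thesis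
    by (simp add: cinner_self)
qed

lemma bounded_clinear_bounded_linear: "bounded_clinear A \<Longrightarrow> bounded_linear A"
  and bounded_clinear_scaleC: "bounded_clinear A \<Longrightarrow> A (c *\<^sub>C x) = c *\<^sub>C A x"
  by (auto simp: bounded_clinear_def)

lemma bounded_clinear_funpow:
  "bounded_clinear T \<Longrightarrow> bounded_clinear (T ^^ n)" for T :: "'a::complex_inner \<Rightarrow> 'a"
proof (induction n)
  case 0
  then show ?case
    by (simp add: bounded_clinear_def id_def bounded_linear_ident)
next
  case (Suc n)
  then show ?case
    by (auto simp: bounded_clinear_def o_def intro: bounded_linear_compose)
qed

lemma bounded_clinear_funpow_zero:
  "bounded_clinear T \<Longrightarrow> (T ^^ n) 0 = 0" for T :: "'a::complex_inner \<Rightarrow> 'a"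
  using bounded_clinear_bounded_linear[OF bounded_clinear_funpow, of T n]
  by (metis bounded_linear.linear linear_0)

lemma subspace_closure:
  fixes S :: "'a::complex_inner set"
  assumes "complex_vector.subspace S"
  shows "complex_vector.subspace (closure S)"
  unfolding complex_vector.subspace_def
proof (intro conjI ballI allI)
  show "0 \<in> closure S"
    using assms closure_subset complex_vector.subspace_0 by blast
next
  fix x y assume "x \<in> closure S" "y \<in> closure S"
  then obtain f g where "\<And>n. f n \<in> S" "f \<longlonglongrightarrow> x" "\<And>n. g n \<in> S" "g \<longlonglongrightarrow> y"
    by (metis closure_sequential)
  then have "\<And>n. f n + g n \<in> S" "(\<lambda>n. f n + g n) \<longlonglongrightarrow> x + y"
    using assms by (auto intro: tendsto_add complex_vector.subspace_add)
  then show "x + y \<in> closure S"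
    unfolding closure_sequential by (intro exI[of _ "\<lambda>n. f n + g n"]) simp
next
  fix c x assume "x \<in> closure S"
  then obtain f where "\<And>n. f n \<in> S" "f \<longlonglongrightarrow> x"
    by (metis closure_sequential)
  then have "\<And>n. c *\<^sub>C f n \<in> S" "(\<lambda>n. c *\<^sub>C f n) \<longlonglongrightarrow> c *\<^sub>C x"
    using assms by (auto intro: scaleC.tendsto complex_vector.subspace_scale)
  then show "c *\<^sub>C x \<in> closure S"
    unfolding closure_sequential by (intro exI[of _ "\<lambda>n. c *\<^sub>C f n"]) simp
qed

lemma subspace_closed_cspan: "complex_vector.subspace (closed_cspan S)"
  unfolding closed_cspan_def by (intro subspace_closure complex_vector.subspace_span)

lemma closed_closed_cspan: "closed (closed_cspan S)"
  by (simp add: closed_cspan_def)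

text \<open>A vector of a closed linear span is, by density, tested on the span itself. This
  is how norms are estimated from scalar products with the vectors \<open>p(T)\<close>.\<close>

lemma norm_le_if_cinner_le_on_cspan:
  fixes e :: "'a::complex_inner"
  assumes e: "e \<in> closed_cspan S" and C: "C \<ge> 0"
    and le: "\<And>h. h \<in> cspan S \<Longrightarrow> cmod (cinner h e) \<le> C * norm h"
  shows "norm e \<le> C"
proof -
  have "closed {h. cmod (cinner h e) \<le> C * norm h}"
    by (intro closed_Collect_le continuous_intros cinner.continuous_on)
  then have "closed_cspan S \<subseteq> {h. cmod (cinner h e) \<le> C * norm h}"
    unfolding closed_cspan_def by (intro closure_minimal) (auto intro: le)
  with e have "cmod (cinner e e) \<le> C * norm e"
    by auto
  then have "norm e * norm e \<le> C * norm e"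
    by (simp add: cmod_cinner_self)
  then show ?thesis
    using C by (cases "e = 0") auto
qed

section \<open>Orthogonal projections, the Riesz theorem and adjoints\<close>

text \<open>By the parallelogram law the sets of almost closest points to \<open>x\<close> in \<open>M\<close> shrink in
  diameter, so completeness yields a closest point \<open>y\<close>. Minimality along each
  line \<open>y + t z\<close> makes \<open>x - y\<close> orthogonal to \<open>z\<close> in the real sense; applying this
  to \<open>z\<close> and \<open>\<i> z\<close> gives orthogonality in the complex sense.\<close>

lemma orthogonal_projection_exists:
  fixes M :: "'a::chilbert_space set"
  assumes sub: "complex_vector.subspace M" and cl: "closed M"
  shows "\<exists>y\<in>M. \<forall>z\<in>M. cinner (x - y) z = 0"
proof -
  have M0: "0 \<in> M" and Madd: "\<And>a b. a \<in> M \<Longrightarrow> b \<in> M \<Longrightarrow> a + b \<in> M"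
    and Msc: "\<And>c a. a \<in> M \<Longrightarrow> c *\<^sub>C a \<in> M" and MscR: "\<And>r a. a \<in> M \<Longrightarrow> r *\<^sub>R a \<in> M"
    using sub by (auto simp: complex_vector.subspace_def scaleR_eq_scaleC)
  define D where "D = (INF y\<in>M. (norm (x - y))\<^sup>2)"
  define S where "S n = {y\<in>M. (norm (x - y))\<^sup>2 \<le> D + inverse (Suc n)}" for n :: nat
  have bdd: "bdd_below ((\<lambda>y. (norm (x - y))\<^sup>2) ` M)"
    by (rule bdd_belowI[of _ 0]) auto
  have D_le: "D \<le> (norm (x - y))\<^sup>2" if "y \<in> M" for y
    unfolding D_def by (rule cINF_lower[OF bdd that])
  have diam: "(dist a b)\<^sup>2 \<le> 4 * inverse (Suc n)" if "a \<in> S n" "b \<in> S n" for a b n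
  proof -
    have "D \<le> (norm (x - (1/2) *\<^sub>R (a + b)))\<^sup>2"
      using that by (intro D_le MscR Madd) (auto simp: S_def)
    moreover have "(norm (a - b))\<^sup>2 = 2 * (norm (x - a))\<^sup>2 + 2 * (norm (x - b))\<^sup>2
        - 4 * (norm (x - (1/2) *\<^sub>R (a + b)))\<^sup>2"
      by (simp add: power2_norm_eq_inner inner_simps inner_commute field_simps)
    moreover have "(norm (x - a))\<^sup>2 \<le> D + inverse (Suc n)" "(norm (x - b))\<^sup>2 \<le> D + inverse (Suc n)"
      using that by (auto simp: S_def)
    ultimately show ?thesis
      unfolding dist_norm by linarith
  qed
  have "\<exists>y. \<forall>n. y \<in> S n"
  proof (rule decreasing_closed_nest)
    show "closed (S n)" for n
    proof -
      have "S n = M \<inter> {y. (norm (x - y))\<^sup>2 \<le> D + inverse (Suc n)}"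
        by (auto simp: S_def)
      then show ?thesis
        by (auto intro!: closed_Int cl closed_Collect_le continuous_intros)
    qed
    show "S n \<noteq> {}" for n
    proof -
      have "D < D + inverse (Suc n)"
        by simp
      then obtain y where "y \<in> M" "(norm (x - y))\<^sup>2 < D + inverse (Suc n)"
        using cINF_less_iff[OF _ bdd, of "D + inverse (Suc n)"] M0 unfolding D_def by auto
      then show ?thesis
        by (auto simp: S_def intro: less_imp_le)
    qed
    show "S n \<subseteq> S m" if "m \<le> n" for m n
    proof -
      have "inverse (real (Suc n)) \<le> inverse (real (Suc m))"
        using that by (intro le_imp_inverse_le) auto
      then show ?thesis
        unfolding S_def by (intro Collect_mono) (meson add_left_mono order_trans)
    qed
    show "\<exists>n. \<forall>a\<in>S n. \<forall>b\<in>S n. dist a b < e" if "0 < e" for e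
    proof -
      have "0 < e\<^sup>2 / 4"
        using that by simp
      then obtain n where n: "inverse (real (Suc n)) < e\<^sup>2 / 4"
        by (metis reals_Archimedean)
      have "dist a b < e" if "a \<in> S n" "b \<in> S n" for a b
      proof (rule power2_less_imp_less)
        show "(dist a b)\<^sup>2 < e\<^sup>2"
          using diam[OF that] n by linarith
      qed (use \<open>0 < e\<close> in simp)
      then show ?thesis
        by blast
    qed
  qed blast
  then obtain y where y: "\<And>n. y \<in> S n"
    by blast
  have yM: "y \<in> M"
    using y[of 0] by (simp add: S_def)
  have yD: "(norm (x - y))\<^sup>2 \<le> D"
  proof (rule LIMSEQ_le_const)
    show "(\<lambda>n. D + inverse (real (Suc n))) \<longlonglongrightarrow> D"
      by (rule LIMSEQ_inverse_real_of_nat_add)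
    show "\<exists>N. \<forall>n\<ge>N. (norm (x - y))\<^sup>2 \<le> D + inverse (real (Suc n))"
      using y by (auto simp: S_def)
  qed
  have real_orth: "inner (x - y) z = 0" if z: "z \<in> M" for z
  proof (cases "z = 0")
    case False
    define t where "t = inner (x - y) z / (norm z)\<^sup>2"
    have "(norm (x - y))\<^sup>2 \<le> (norm (x - (y + t *\<^sub>R z)))\<^sup>2"
      using yD D_le[OF Madd[OF yM MscR[OF z]], of t] by linarith
    also have "x - (y + t *\<^sub>R z) = (x - y) - t *\<^sub>R z"
      by simp
    also have "(norm ((x - y) - t *\<^sub>R z))\<^sup>2 = (norm (x - y))\<^sup>2 - 2 * t * inner (x - y) z + t\<^sup>2 * (norm z)\<^sup>2"
      unfolding power2_norm_eq_inner inner_diff_left[of "x - y"] inner_diff_right[of _ "x - y"]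
      by (simp add: inner_commute power2_eq_square algebra_simps)
    also have "t * inner (x - y) z = t\<^sup>2 * (norm z)\<^sup>2"
      using False by (simp add: t_def power2_eq_square)
    then have "2 * t * inner (x - y) z = 2 * (t\<^sup>2 * (norm z)\<^sup>2)"
      by simp
    finally have "t\<^sup>2 * (norm z)\<^sup>2 \<le> 0"
      by simp
    then have "t = 0"
      using False by (simp add: mult_le_0_iff power2_eq_square)
        (metis not_sum_squares_lt_zero mult_eq_0_iff add.right_neutral linorder_not_less
          order_antisym_conv zero_le_square)
    then show ?thesis
      using False by (simp add: t_def)
  qed simp
  have "cinner (x - y) z = 0" if z: "z \<in> M" for z
    using real_orth[OF z] real_orth[OF Msc[OF z, of \<i>]]
    by (simp add: complex_eq_iff inner_eq_Re_cinner cinner_scaleC_right)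
  with yM show ?thesis
    by blast
qed

lemma
  fixes M :: "'a::chilbert_space set"
  assumes sub: "complex_vector.subspace M" and cl: "closed M"
  shows cproj_in: "cproj M x \<in> M"
    and cinner_diff_cproj: "z \<in> M \<Longrightarrow> cinner (x - cproj M x) z = 0"
proof -
  have "\<exists>!y. y \<in> M \<and> (\<forall>z\<in>M. cinner (x - y) z = 0)"
  proof (rule ex_ex1I)
    show "\<exists>y. y \<in> M \<and> (\<forall>z\<in>M. cinner (x - y) z = 0)"
      using orthogonal_projection_exists[OF assms] by blast
  next
    fix y y' assume a: "y \<in> M \<and> (\<forall>z\<in>M. cinner (x - y) z = 0)"
      "y' \<in> M \<and> (\<forall>z\<in>M. cinner (x - y') z = 0)"
    then have "y - y' \<in> M"
      using sub complex_vector.subspace_diff by blast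
    with a have "cinner (x - y') (y - y') - cinner (x - y) (y - y') = 0"
      by simp
    then have "cinner (y - y') (y - y') = 0"
      by (simp flip: cinner.diff_left)
    then show "y = y'"
      by (simp add: cinner_self)
  qed
  from theI'[OF this] show "cproj M x \<in> M" "z \<in> M \<Longrightarrow> cinner (x - cproj M x) z = 0"
    unfolding cproj_def by auto
qed

lemma cinner_cproj_right:
  fixes M :: "'a::chilbert_space set"
  assumes "complex_vector.subspace M" "closed M" "z \<in> M"
  shows "cinner z (cproj M x) = cinner z x"
proof -
  have "cinner z (x - cproj M x) = 0"
    using cinner_diff_cproj[OF assms, of x] by (metis cinner_commute complex_cnj_zero)
  then show ?thesis
    by (simp add: cinner.diff_right)
qed

lemma norm_cproj_le:
  fixes M :: "'a::chilbert_space set"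
  assumes "complex_vector.subspace M" "closed M"
  shows "norm (cproj M x) \<le> norm x"
proof -
  let ?y = "cproj M x"
  have "cinner ?y ?y = cinner ?y x"
    by (rule cinner_cproj_right[OF assms cproj_in[OF assms]])
  then have "norm ?y * norm ?y \<le> norm ?y * norm x"
    using cmod_cinner_le[of ?y x] cmod_cinner_self[of ?y] by simp
  then show ?thesis
    by (cases "?y = 0") auto
qed

lemma Riesz_representation:
  fixes f :: "'a::chilbert_space \<Rightarrow> complex"
  assumes f: "bounded_clinear f"
  shows "\<exists>z. \<forall>x. f x = cinner x z"
proof (cases "\<forall>x. f x = 0")
  case True
  then show ?thesis
    by (intro exI[of _ 0]) (simp add: cinner.zero_right)
next
  case False
  then obtain x0 where x0: "f x0 \<noteq> 0"
    by blast
  interpret f: bounded_linear f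
    by (rule bounded_clinear_bounded_linear[OF f])
  have fC: "f (c *\<^sub>C x) = c * f x" for c x
    using bounded_clinear_scaleC[OF f] by (simp add: scaleC_complex_def)
  let ?N = "{x. f x = 0}"
  have sub: "complex_vector.subspace ?N"
    by (auto simp: complex_vector.subspace_def f.zero f.add fC)
  have cl: "closed ?N"
    by (intro closed_Collect_eq continuous_intros f.continuous_on)
  \<comment> \<open>\<open>u\<close> spans the orthogonal complement of the kernel of \<open>f\<close>.\<close>
  define u where "u = x0 - cproj ?N x0"
  have fu: "f u \<noteq> 0"
    using x0 cproj_in[OF sub cl, of x0] by (simp add: u_def f.diff)
  then have uu: "cinner u u \<noteq> 0"
    by (auto simp: cinner_self f.zero)
  have "f x = cinner x ((cnj (f u) / cinner u u) *\<^sub>C u)" for x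
  proof -
    have "f (x - (f x / f u) *\<^sub>C u) = 0"
      using fu by (simp add: f.diff fC)
    then have "cinner u (x - (f x / f u) *\<^sub>C u) = 0"
      unfolding u_def by (intro cinner_diff_cproj[OF sub cl]) simp
    then have "cinner (x - (f x / f u) *\<^sub>C u) u = 0"
      by (metis cinner_commute complex_cnj_zero)
    then have "cinner x u = f x / f u * cinner u u"
      by (simp add: cinner.diff_left cinner_scaleC_left)
    then show ?thesis
      using fu uu by (simp add: cinner_scaleC_right cinner_commute[of u u, symmetric])
  qed
  then show ?thesis
    by blast
qed

lemma cinner_cadjoint:
  fixes A :: "'a::chilbert_space \<Rightarrow> 'b::chilbert_space"
  assumes A: "bounded_clinear A"
  shows "cinner x (cadjoint A y) = cinner (A x) y"
proof -
  have "bounded_linear (\<lambda>x. cinner (A x) y)"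
    by (intro bounded_linear_compose[OF cinner.bounded_linear_left]
        bounded_clinear_bounded_linear A)
  then have "bounded_clinear (\<lambda>x. cinner (A x) y)"
    by (simp add: bounded_clinear_def bounded_clinear_scaleC[OF A] cinner_scaleC_left
        scaleC_complex_def)
  then obtain z where z: "\<And>x. cinner (A x) y = cinner x z"
    using Riesz_representation by blast
  have "\<exists>!z. \<forall>x. cinner (A x) y = cinner x z"
  proof (rule ex1I[of _ z])
    show "z' = z" if "\<forall>x. cinner (A x) y = cinner x z'" for z'
      by (rule cinner_eq_right_imp_eq) (metis that z)
    show "\<forall>x. cinner (A x) y = cinner x z"
      using z by blast
  qed
  from theI'[OF this] have "\<forall>x. cinner (A x) y = cinner x (cadjoint A y)"
    unfolding cadjoint_def .
  then show ?thesis
    by (simp only:)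
qed

lemma cadjoint_zero:
  "bounded_clinear A \<Longrightarrow> cadjoint A 0 = 0"
  for A :: "'a::chilbert_space \<Rightarrow> 'b::chilbert_space"
  by (rule cinner_eq_right_imp_eq) (simp add: cinner_cadjoint cinner.zero_right)

lemma norm_cadjoint_le:
  fixes A :: "'a::chilbert_space \<Rightarrow> 'b::chilbert_space"
  assumes A: "bounded_clinear A"
  obtains C where "\<And>y. norm (cadjoint A y) \<le> C * norm y"
proof -
  obtain C where C: "C \<ge> 0" "\<And>x. norm (A x) \<le> C * norm x"
    using bounded_linear.nonneg_bounded[OF bounded_clinear_bounded_linear[OF A]]
    by (metis mult.commute)
  have "norm (cadjoint A y) \<le> C * norm y" for y
  proof -
    let ?e = "cadjoint A y"
    have "norm ?e * norm ?e = cmod (cinner ?e ?e)"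
      by (simp add: cmod_cinner_self)
    also have "\<dots> = cmod (cinner (A ?e) y)"
      by (simp add: cinner_cadjoint[OF A])
    also have "\<dots> \<le> norm (A ?e) * norm y"
      by (rule cmod_cinner_le)
    also have "\<dots> \<le> (C * norm ?e) * norm y"
      by (intro mult_right_mono C) simp
    finally have "norm ?e * norm ?e \<le> norm ?e * (C * norm y)"
      by (simp add: mult_ac)
    then show ?thesis
      using C(1) by (cases "?e = 0") auto
  qed
  with that show ?thesis
    by blast
qed

lemma ker_adj_iff:
  assumes "bounded_clinear T"
  shows "x \<in> ker_adj T \<longleftrightarrow> (\<forall>a. cinner (T a) x = 0)"
proof -
  have "cadjoint T x = 0 \<longleftrightarrow> (\<forall>a. cinner (T a) x = 0)"
  proof
    assume "cadjoint T x = 0"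
    then show "\<forall>a. cinner (T a) x = 0"
      by (simp add: cinner.zero_right flip: cinner_cadjoint[OF assms])
  next
    assume *: "\<forall>a. cinner (T a) x = 0"
    show "cadjoint T x = 0"
      by (rule cinner_eq_right_imp_eq) (simp add: cinner_cadjoint[OF assms] cinner.zero_right *)
  qed
  then show ?thesis
    by (simp add: ker_adj_def)
qed

lemma subspace_ker_adj:
  "bounded_clinear T \<Longrightarrow> complex_vector.subspace (ker_adj T)"
  by (simp add: complex_vector.subspace_def ker_adj_iff cinner.zero_right
      cinner_add_right cinner_scaleC_right)

lemma closed_ker_adj:
  assumes "bounded_clinear T"
  shows "closed (ker_adj T)"
proof -
  have "ker_adj T = (\<Inter>a. {x. cinner (T a) x = 0})"
    using ker_adj_iff[OF assms] by auto
  also have "closed \<dots>"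
    by (intro closed_INT ballI closed_Collect_eq continuous_intros cinner.continuous_on)
  finally show ?thesis .
qed

section \<open>The Cauchy dual\<close>

text \<open>Let \<open>L\<close> be a left inverse of \<open>T\<close>. The range of \<open>T\<close> is closed, being the fixed point
  set of \<open>T \<circ> L\<close>; projecting \<open>L\<^sup>* b\<close> onto it yields \<open>T c\<close> with \<open>T\<^sup>* T c = b\<close>.\<close>

lemma surj_cadjoint_comp_if_left_invertible:
  fixes T :: "'a::chilbert_space \<Rightarrow> 'a"
  assumes T: "bounded_clinear T" and "left_invertible T"
  shows "surj (cadjoint T \<circ> T)"
proof -
  from assms obtain L where L: "bounded_clinear L" and LT: "\<And>x. L (T x) = x"
    unfolding left_invertible_def by blast
  interpret T: bounded_linear T
    by (rule bounded_clinear_bounded_linear[OF T])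
  interpret L: bounded_linear L
    by (rule bounded_clinear_bounded_linear[OF L])
  have "range T = {x. T (L x) = x}"
    by (auto simp: LT) (metis rangeI)
  then have cl: "closed (range T)"
    by (auto intro!: closed_Collect_eq continuous_intros T.continuous_on L.continuous_on)
  have sub: "complex_vector.subspace (range T)"
    unfolding complex_vector.subspace_def
  proof (intro conjI ballI allI)
    show "0 \<in> range T"
      by (metis T.zero rangeI)
    show "x + y \<in> range T" if "x \<in> range T" "y \<in> range T" for x y
      using that by (auto simp flip: T.add)
    show "c *\<^sub>C x \<in> range T" if "x \<in> range T" for c x
      using that by (auto simp flip: bounded_clinear_scaleC[OF T])
  qed
  have "\<exists>c. (cadjoint T \<circ> T) c = b" for b
  proof -
    obtain c where c: "cproj (range T) (cadjoint L b) = T c"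
      using cproj_in[OF sub cl] by blast
    have "cinner a (cadjoint T (T c)) = cinner a b" for a
    proof -
      have "cinner a (cadjoint T (T c)) = cinner (T a) (cproj (range T) (cadjoint L b))"
        by (simp add: cinner_cadjoint[OF T] c)
      also have "\<dots> = cinner (L (T a)) b"
        by (simp add: cinner_cproj_right[OF sub cl] cinner_cadjoint[OF L])
      finally show ?thesis
        by (simp add: LT)
    qed
    then show ?thesis
      by (intro exI[of _ c]) (simp add: cinner_eq_right_imp_eq)
  qed
  then show ?thesis
    unfolding surj_def by metis
qed

context
  fixes T :: "'a::chilbert_space \<Rightarrow> 'a"
  assumes T: "bounded_clinear T" and left_inv: "left_invertible T"
begin

lemma cauchy_dual_obtain:
  obtains c where "cauchy_dual T b = T c" "cadjoint T (T c) = b"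
  using surj_f_inv_f[OF surj_cadjoint_comp_if_left_invertible[OF T left_inv], of b]
  by (auto simp: cauchy_dual_def)

lemma cinner_cauchy_dual: "cinner (T a) (cauchy_dual T b) = cinner a b"
  by (rule cauchy_dual_obtain[of b]) (metis cinner_cadjoint[OF T])

lemma cinner_ker_adj_cauchy_dual:
  assumes "x \<in> ker_adj T"
  shows "cinner x (cauchy_dual T b) = 0"
proof -
  obtain c where "cauchy_dual T b = T c"
    by (rule cauchy_dual_obtain)
  moreover have "cinner (T c) x = 0"
    using assms ker_adj_iff[OF T] by blast
  ultimately show ?thesis
    by (metis cinner_commute complex_cnj_zero)
qed

lemma norm_cauchy_dual_le:
  obtains C where "C \<ge> 0" "\<And>b. norm (cauchy_dual T b) \<le> C * norm b"
proof -
  obtain L where L: "bounded_clinear L" and LT: "\<And>x. L (T x) = x"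
    using left_inv unfolding left_invertible_def by blast
  obtain C where C: "C \<ge> 0" "\<And>x. norm (L x) \<le> C * norm x"
    using bounded_linear.nonneg_bounded[OF bounded_clinear_bounded_linear[OF L]]
    by (metis mult.commute)
  have "norm (cauchy_dual T b) \<le> C * norm b" for b
  proof -
    obtain c where c: "cauchy_dual T b = T c"
      by (rule cauchy_dual_obtain)
    have "cinner (T c) (T c) = cinner c b"
      using cinner_cauchy_dual[of c b] c by simp
    then have "norm (T c) * norm (T c) \<le> norm c * norm b"
      using cmod_cinner_le[of c b] cmod_cinner_self[of "T c"] by simp
    also have "\<dots> \<le> (C * norm (T c)) * norm b"
      using C(2)[of "T c"] by (intro mult_right_mono) (auto simp: LT)
    finally have "norm (T c) * norm (T c) \<le> norm (T c) * (C * norm b)"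
      by (simp add: mult_ac)
    then show ?thesis
      using C(1) unfolding c by (cases "T c = 0") auto
  qed
  with C(1) that show ?thesis
    by blast
qed

lemma dual_sum_bounded:
  obtains C where "\<And>x. norm (dual_sum T n w x) \<le> C * norm x"
proof -
  obtain C where C: "C \<ge> 0" "\<And>b. norm (cauchy_dual T b) \<le> C * norm b"
    by (rule norm_cauchy_dual_le) blast
  have pow: "norm ((cauchy_dual T ^^ k) x) \<le> C ^ k * norm x" for k x
  proof (induction k)
    case (Suc k)
    have "norm ((cauchy_dual T ^^ Suc k) x) \<le> C * norm ((cauchy_dual T ^^ k) x)"
      by (simp add: C(2))
    also have "\<dots> \<le> C * (C ^ k * norm x)"
      by (intro mult_left_mono Suc.IH C(1))
    finally show ?case
      by (simp add: mult.assoc)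
  qed simp
  have "norm (dual_sum T n w x) \<le> (\<Sum>k\<le>n. cmod w ^ k * C ^ k) * norm x" for x
    unfolding dual_sum_def sum_distrib_right
    by (intro sum_norm_le)
      (auto simp: norm_scaleC norm_power mult.assoc intro!: mult_left_mono pow)
  then show ?thesis
    using that by blast
qed

text \<open>The powers of \<open>T\<close> and of its Cauchy dual \<open>T'\<close> are biorthogonal on \<open>ker T\<^sup>*\<close>, because
  \<open>T'\<^sup>* T = I\<close> cancels a factor from both sides, and both \<open>T\<^sup>*\<close> and \<open>T'\<^sup>*\<close> annihilate
  \<open>ker T\<^sup>*\<close>.\<close>

lemma cinner_funpow_cauchy_dual_funpow:
  assumes "x \<in> ker_adj T" "y \<in> ker_adj T"
  shows "cinner ((T ^^ j) x) ((cauchy_dual T ^^ k) y) = (if j = k then cinner x y else 0)"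
proof (induction j arbitrary: k)
  case 0
  then show ?case
    by (cases k) (auto simp: cinner_ker_adj_cauchy_dual[OF assms(1)])
next
  case (Suc j)
  then show ?case
    using assms(2) ker_adj_iff[OF T] by (cases k) (auto simp: cinner_cauchy_dual)
qed

end

section \<open>Polynomials with coefficients in the wandering subspace\<close>

lemma vpoly_eq_sum:
  "degree p \<le> n \<Longrightarrow> vpoly p w = (\<Sum>k\<le>n. w ^ k *\<^sub>C coeff (p::'a::chilbert_space poly) k)"
  unfolding vpoly_def
  by (intro sum.mono_neutral_left) (auto simp: coeff_eq_0 scaleC.zero_right)

lemma vpoly_add: "vpoly (p + q) w = vpoly p w + vpoly (q::'a::chilbert_space poly) w"
proof -
  let ?n = "max (degree p) (degree q)"
  show ?thesis
    unfolding vpoly_eq_sum[of p ?n, simplified] vpoly_eq_sum[of q ?n, simplified]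
      vpoly_eq_sum[OF degree_add_le_max]
    by (simp add: scaleC_add_right sum.distrib)
qed

lemma coeff_map_poly_scaleC: "coeff (map_poly (scaleC c) p) k = c *\<^sub>C coeff (p::'a::chilbert_space poly) k"
  by (simp add: coeff_map_poly scaleC.zero_right)

lemma vpoly_map_poly_scaleC: "vpoly (map_poly (scaleC c) p) w = c *\<^sub>C vpoly (p::'a::chilbert_space poly) w"
  unfolding vpoly_eq_sum[OF map_poly_degree_leq] vpoly_def[of p]
  by (simp add: coeff_map_poly_scaleC scaleC.sum_right scaleC_scaleC mult.commute)

lemma subspace_wand_space: "complex_vector.subspace (wand_space T n)"
  and closed_wand_space: "closed (wand_space T n)"
  unfolding wand_space_def by (rule subspace_closed_cspan closed_closed_cspan)+

context
  fixes T :: "'a::chilbert_space \<Rightarrow> 'a"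
  assumes T: "bounded_clinear T"
begin

lemma vpoly_op_eq_sum:
  assumes "degree p \<le> n"
  shows "vpoly_op p T = (\<Sum>k\<le>n. (T ^^ k) (coeff p k))"
  unfolding vpoly_op_def using assms
  by (intro sum.mono_neutral_left) (auto simp: coeff_eq_0 bounded_clinear_funpow_zero[OF T])

lemma vpoly_op_add: "vpoly_op (p + q) T = vpoly_op p T + vpoly_op q T"
proof -
  let ?n = "max (degree p) (degree q)"
  have "(T ^^ k) (a + b) = (T ^^ k) a + (T ^^ k) b" for k a b
    using bounded_clinear_bounded_linear[OF bounded_clinear_funpow[OF T]]
    by (metis bounded_linear.linear linear_add)
  then show ?thesis
    unfolding vpoly_op_eq_sum[of p ?n, simplified] vpoly_op_eq_sum[of q ?n, simplified]
      vpoly_op_eq_sum[OF degree_add_le_max]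
    by (simp add: sum.distrib)
qed

lemma vpoly_op_map_poly_scaleC: "vpoly_op (map_poly (scaleC c) p) T = c *\<^sub>C vpoly_op p T"
  unfolding vpoly_op_eq_sum[OF map_poly_degree_leq] vpoly_op_def[of p]
  by (simp add: coeff_map_poly_scaleC scaleC.sum_right
      bounded_clinear_scaleC[OF bounded_clinear_funpow[OF T]])

lemma ker_polys_add: "p \<in> ker_polys T \<Longrightarrow> q \<in> ker_polys T \<Longrightarrow> p + q \<in> ker_polys T"
  using subspace_ker_adj[OF T] by (simp add: ker_polys_def complex_vector.subspace_add)

lemma ker_polys_map_poly_scaleC: "p \<in> ker_polys T \<Longrightarrow> map_poly (scaleC c) p \<in> ker_polys T"
  using subspace_ker_adj[OF T]
  by (simp add: ker_polys_def coeff_map_poly_scaleC complex_vector.subspace_scale)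

lemma vpoly_in_ker_adj: "p \<in> ker_polys T \<Longrightarrow> vpoly p w \<in> ker_adj T"
  using subspace_ker_adj[OF T]
  by (auto simp: ker_polys_def vpoly_def intro!: complex_vector.subspace_sum
      complex_vector.subspace_scale)

text \<open>The set \<open>I\<close> of admissible exponents is \<open>UNIV\<close> for the wandering subspace property
  and \<open>{..n}\<close> for the space \<open>M\<^sub>n\<close>.\<close>

lemma cspan_wandering_eq_vpoly_op:
  "cspan (\<Union>k\<in>I. (T ^^ k) ` ker_adj T) =
    {vpoly_op p T | p. p \<in> ker_polys T \<and> (\<forall>k. coeff p k \<noteq> 0 \<longrightarrow> k \<in> I)}" (is "?L = ?R")
proof
  have K0: "0 \<in> ker_adj T"
    using subspace_ker_adj[OF T] by (rule complex_vector.subspace_0)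
  show "?L \<subseteq> ?R"
  proof (rule complex_vector.span_minimal)
    show "(\<Union>k\<in>I. (T ^^ k) ` ker_adj T) \<subseteq> ?R"
    proof safe
      fix k x assume "k \<in> I" "x \<in> ker_adj T"
      then have "monom x k \<in> ker_polys T \<and> (\<forall>j. coeff (monom x k) j \<noteq> 0 \<longrightarrow> j \<in> I)"
        using K0 by (auto simp: ker_polys_def)
      moreover have "vpoly_op (monom x k) T = (T ^^ k) x"
      proof -
        have "vpoly_op (monom x k) T = (\<Sum>j\<le>k. if j = k then (T ^^ k) x else 0)"
          unfolding vpoly_op_eq_sum[OF degree_monom_le]
          by (intro sum.cong) (auto simp: bounded_clinear_funpow_zero[OF T])
        then show ?thesis
          by simp
      qed
      ultimately show "\<exists>p. (T ^^ k) x = vpoly_op p T \<and> p \<in> ker_polys T \<and>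
          (\<forall>k. coeff p k \<noteq> 0 \<longrightarrow> k \<in> I)"
        by metis
    qed
    show "complex_vector.subspace ?R"
      unfolding complex_vector.subspace_def
    proof (intro conjI ballI allI)
      have "vpoly_op 0 T = 0"
        using bounded_clinear_scaleC[OF T, of 0 0] vpoly_op_add[of 0 0] by simp
      then show "0 \<in> ?R"
        using K0 by (auto simp: ker_polys_def intro!: exI[of _ 0])
    next
      fix a b assume "a \<in> ?R" "b \<in> ?R"
      then obtain p q where "a = vpoly_op p T" "p \<in> ker_polys T" "\<forall>k. coeff p k \<noteq> 0 \<longrightarrow> k \<in> I"
        "b = vpoly_op q T" "q \<in> ker_polys T" "\<forall>k. coeff q k \<noteq> 0 \<longrightarrow> k \<in> I"
        by blast
      then have "a + b = vpoly_op (p + q) T \<and> p + q \<in> ker_polys T \<and>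
          (\<forall>k. coeff (p + q) k \<noteq> 0 \<longrightarrow> k \<in> I)"
        by (metis vpoly_op_add ker_polys_add coeff_add add_0)
      then show "a + b \<in> ?R"
        by blast
    next
      fix c a assume "a \<in> ?R"
      then obtain p where "a = vpoly_op p T" "p \<in> ker_polys T" "\<forall>k. coeff p k \<noteq> 0 \<longrightarrow> k \<in> I"
        by blast
      then have "c *\<^sub>C a = vpoly_op (map_poly (scaleC c) p) T \<and>
          map_poly (scaleC c) p \<in> ker_polys T \<and>
          (\<forall>k. coeff (map_poly (scaleC c) p) k \<noteq> 0 \<longrightarrow> k \<in> I)"
        by (metis vpoly_op_map_poly_scaleC ker_polys_map_poly_scaleC coeff_map_poly_scaleC
            scaleC.zero_right)
      then show "c *\<^sub>C a \<in> ?R"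
        by blast
    qed
  qed
  show "?R \<subseteq> ?L"
  proof safe
    fix p assume p: "p \<in> ker_polys T" "\<forall>k. coeff p k \<noteq> 0 \<longrightarrow> k \<in> I"
    have "(T ^^ k) (coeff p k) \<in> ?L" for k
    proof (cases "coeff p k = 0")
      case True
      then have "(T ^^ k) (coeff p k) = 0"
        by (simp add: bounded_clinear_funpow_zero[OF T])
      then show ?thesis
        by (simp add: complex_vector.span_zero)
    next
      case False
      with p show ?thesis
        by (intro complex_vector.span_base) (auto simp: ker_polys_def)
    qed
    then show "vpoly_op p T \<in> ?L"
      unfolding vpoly_op_def by (intro complex_vector.span_sum)
  qed
qed

lemma cspan_wand_space_eq:
  "cspan (\<Union>k\<le>n. (T ^^ k) ` ker_adj T) = {vpoly_op p T | p. p \<in> ker_polys T \<and> degree p \<le> n}"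
proof -
  have "(\<forall>k. coeff p k \<noteq> 0 \<longrightarrow> k \<in> {..n}) \<longleftrightarrow> degree p \<le> n" for p :: "'a poly"
    by (metis atMost_iff coeff_eq_0 degree_le le_degree le_trans linorder_not_less)
  then show ?thesis
    unfolding cspan_wandering_eq_vpoly_op by simp
qed

lemma vpoly_op_in_wand_space:
  "p \<in> ker_polys T \<Longrightarrow> degree p \<le> n \<Longrightarrow> vpoly_op p T \<in> wand_space T n"
  unfolding wand_space_def closed_cspan_def cspan_wand_space_eq
  by (intro subsetD[OF closure_subset]) blast

lemma dense_vpoly_op:
  assumes "wandering_subspace_property T"
  shows "closure {vpoly_op p T | p. p \<in> ker_polys T} = UNIV"
  using assms cspan_wandering_eq_vpoly_op[of UNIV]
  by (simp add: wandering_subspace_property_def closed_cspan_def)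

end

text \<open>By biorthogonality, \<open>S\<^sub>n(w)\<close> reproduces the value at \<open>w\<close> of every polynomial of
  degree at most \<open>n\<close>.\<close>

lemma cinner_vpoly_op_cproj_dual_sum:
  fixes T :: "'a::chilbert_space \<Rightarrow> 'a"
  assumes T: "bounded_clinear T" and left_inv: "left_invertible T"
    and p: "p \<in> ker_polys T" "degree p \<le> n" and y: "y \<in> ker_adj T"
  shows "cinner (vpoly_op p T) (cproj (wand_space T n) (dual_sum T n w y)) =
    cinner (vpoly p w) y"
proof -
  have pk: "coeff p k \<in> ker_adj T" for k
    using p by (simp add: ker_polys_def)
  have "cinner (vpoly_op p T) (dual_sum T n w y) =
      (\<Sum>j\<le>n. \<Sum>k\<le>n. w ^ k * cinner ((T ^^ j) (coeff p j)) ((cauchy_dual T ^^ k) y))"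
    unfolding vpoly_op_eq_sum[OF T p(2)] dual_sum_def
    by (simp add: cinner.sum_left cinner.sum_right cinner_scaleC_right sum_distrib_left)
      (rule sum.swap)
  also have "\<dots> = (\<Sum>j\<le>n. \<Sum>k\<le>n. if j = k then w ^ k * cinner (coeff p j) y else 0)"
    by (intro sum.cong refl) (simp add: cinner_funpow_cauchy_dual_funpow[OF T left_inv pk y])
  also have "\<dots> = cinner (vpoly p w) y"
    unfolding vpoly_eq_sum[OF p(2)] by (simp add: cinner.sum_left cinner_scaleC_left)
  finally show ?thesis
    by (simp add: cinner_cproj_right[OF subspace_wand_space closed_wand_space]
        vpoly_op_in_wand_space[OF T] p)
qed

section \<open>Extension of bounded operators given by their graph\<close>

text \<open>The extension is the operator whose graph is the closure of \<open>G\<close>: the estimate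
  \<open>norm v \<le> c * norm h\<close> survives the closure, so the closed graph is single-valued,
  and it turns convergent sequences of arguments into Cauchy sequences of values, so
  the closed graph is total by density. Working with the graph avoids having to show beforehand
  that \<open>p(T) \<mapsto> p(w)\<close> is well defined.\<close>

lemma bounded_clinear_extension_of_graph:
  fixes G :: "('a::complex_inner \<times> 'b::chilbert_space) set"
  assumes add: "\<And>h v h' v'. (h, v) \<in> G \<Longrightarrow> (h', v') \<in> G \<Longrightarrow> (h + h', v + v') \<in> G"
    and scale: "\<And>c h v. (h, v) \<in> G \<Longrightarrow> (c *\<^sub>C h, c *\<^sub>C v) \<in> G"
    and bound: "\<And>h v. (h, v) \<in> G \<Longrightarrow> norm v \<le> c * norm h"
    and dense: "closure (fst ` G) = UNIV"
  shows "\<exists>E. bounded_clinear E \<and> range E \<subseteq> closure (snd ` G) \<and> (\<forall>(h, v)\<in>G. E h = v)"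
proof -
  let ?H = "closure G"
  have diff: "(h - h', v - v') \<in> G" if "(h, v) \<in> G" "(h', v') \<in> G" for h v h' v'
    using add[OF that(1) scale[OF that(2), of "-1"]] by simp
  have addH: "(h + h', v + v') \<in> ?H" if a: "(h, v) \<in> ?H" "(h', v') \<in> ?H" for h v h' v'
  proof -
    obtain f g where fg: "\<And>n. f n \<in> G" "f \<longlonglongrightarrow> (h, v)" "\<And>n. g n \<in> G" "g \<longlonglongrightarrow> (h', v')"
      using a unfolding closure_sequential by blast
    have "f n + g n \<in> G" for n
      using add[of "fst (f n)" "snd (f n)" "fst (g n)" "snd (g n)"] fg(1,3)[of n]
      by (simp add: plus_prod_def)
    moreover have "(\<lambda>n. f n + g n) \<longlonglongrightarrow> (h + h', v + v')"
      using tendsto_add[OF fg(2,4)] by simp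
    ultimately show ?thesis
      unfolding closure_sequential by (intro exI[of _ "\<lambda>n. f n + g n"]) simp
  qed
  have scaleH: "(a *\<^sub>C h, a *\<^sub>C v) \<in> ?H" if hv: "(h, v) \<in> ?H" for a h v
  proof -
    obtain f where f: "\<And>n. f n \<in> G" "f \<longlonglongrightarrow> (h, v)"
      using hv unfolding closure_sequential by blast
    have "(a *\<^sub>C fst (f n), a *\<^sub>C snd (f n)) \<in> G" for n
      using scale[of "fst (f n)" "snd (f n)" a] f(1)[of n] by simp
    moreover have "(\<lambda>n. (a *\<^sub>C fst (f n), a *\<^sub>C snd (f n))) \<longlonglongrightarrow> (a *\<^sub>C h, a *\<^sub>C v)"
      using tendsto_fst[OF f(2)] tendsto_snd[OF f(2)]
      by (intro tendsto_Pair scaleC.tendsto tendsto_const) auto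
    ultimately show ?thesis
      unfolding closure_sequential
      by (intro exI[of _ "\<lambda>n. (a *\<^sub>C fst (f n), a *\<^sub>C snd (f n))"]) simp
  qed
  have boundH: "norm v \<le> c * norm h" if "(h, v) \<in> ?H" for h v
  proof -
    have "?H \<subseteq> {x. norm (snd x) \<le> c * norm (fst x)}"
      using bound by (intro closure_minimal closed_Collect_le continuous_intros) auto
    with that show ?thesis
      by auto
  qed
  have uniq: "v = v'" if "(h, v) \<in> ?H" "(h, v') \<in> ?H" for h v v'
    using boundH[OF addH[OF that(1) scaleH[OF that(2), of "-1"]]] by simp
  have ex: "\<exists>v. (h, v) \<in> ?H" for h
  proof -
    have "h \<in> closure (fst ` G)"
      by (simp add: dense)
    then obtain g where "\<And>n. g n \<in> fst ` G" and glim: "g \<longlonglongrightarrow> h"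
      unfolding closure_sequential by blast
    then have "\<forall>n. \<exists>v. (g n, v) \<in> G"
      by force
    then obtain v where gv: "\<And>n. (g n, v n) \<in> G"
      by metis
    have "Cauchy v"
    proof (rule metric_CauchyI)
      fix e :: real assume e: "0 < e"
      have "0 < e / (\<bar>c\<bar> + 1)"
        using e by simp
      then obtain N where N: "\<And>m n. m \<ge> N \<Longrightarrow> n \<ge> N \<Longrightarrow> dist (g m) (g n) < e / (\<bar>c\<bar> + 1)"
        using metric_CauchyD[OF LIMSEQ_imp_Cauchy[OF glim]] by metis
      have "dist (v m) (v n) < e" if "m \<ge> N" "n \<ge> N" for m n
      proof -
        have "dist (v m) (v n) \<le> c * dist (g m) (g n)"
          unfolding dist_norm by (rule bound[OF diff[OF gv gv]])
        also have "\<dots> \<le> (\<bar>c\<bar> + 1) * dist (g m) (g n)"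
          by (intro mult_right_mono) auto
        also have "\<dots> < e"
          using N[OF that] by (simp add: field_simps)
        finally show ?thesis .
      qed
      then show "\<exists>N. \<forall>m\<ge>N. \<forall>n\<ge>N. dist (v m) (v n) < e"
        by blast
    qed
    then obtain l where "v \<longlonglongrightarrow> l"
      using Cauchy_convergent_iff convergent_def by blast
    then have "(\<lambda>n. (g n, v n)) \<longlonglongrightarrow> (h, l)"
      by (intro tendsto_Pair glim)
    with gv show ?thesis
      unfolding closure_sequential by (intro exI[of _ l] exI[of _ "\<lambda>n. (g n, v n)"]) simp
  qed
  define E where "E h = (SOME v. (h, v) \<in> ?H)" for h
  have EH: "(h, E h) \<in> ?H" for h
    unfolding E_def by (rule someI_ex[OF ex])
  have E_eq: "E h = v" if "(h, v) \<in> ?H" for h v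
    by (rule uniq[OF EH that])
  have Escale: "E (a *\<^sub>C h) = a *\<^sub>C E h" for a h
    by (rule E_eq[OF scaleH[OF EH]])
  have "bounded_clinear E"
    unfolding bounded_clinear_def
  proof (intro conjI allI Escale)
    show "bounded_linear E"
    proof (rule bounded_linear_intro)
      show "E (h + h') = E h + E h'" for h h'
        by (rule E_eq[OF addH[OF EH EH]])
      show "E (r *\<^sub>R h) = r *\<^sub>R E h" for r h
        by (simp add: scaleR_eq_scaleC Escale)
      show "norm (E h) \<le> norm h * c" for h
        using boundH[OF EH] by (simp add: mult.commute)
    qed
  qed
  moreover have "E h \<in> closure (snd ` G)" for h
  proof -
    obtain f where f: "\<And>n. f n \<in> G" "f \<longlonglongrightarrow> (h, E h)"
      using EH[of h] unfolding closure_sequential by blast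
    have "(\<lambda>n. snd (f n)) \<longlonglongrightarrow> E h"
      using tendsto_snd[OF f(2)] by simp
    then show ?thesis
      using f(1) unfolding closure_sequential by (intro exI[of _ "\<lambda>n. snd (f n)"]) simp
  qed
  moreover have "\<forall>(h, v)\<in>G. E h = v"
    using E_eq closure_subset by blast
  ultimately show ?thesis
    by blast
qed

lemma eval_op:
  fixes T :: "'a::chilbert_space \<Rightarrow> 'a"
  assumes T: "bounded_clinear T" and wsp: "wandering_subspace_property T" and w: "w \<in> bpe T"
  shows bounded_clinear_eval_op: "bounded_clinear (eval_op T w)"
    and eval_op_vpoly_op: "p \<in> ker_polys T \<Longrightarrow> eval_op T w (vpoly_op p T) = vpoly p w"
proof -
  from w obtain c where c: "\<And>p. p \<in> ker_polys T \<Longrightarrow> norm (vpoly p w) \<le> c * norm (vpoly_op p T)"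
    unfolding bpe_def by blast
  let ?G = "(\<lambda>p. (vpoly_op p T, vpoly p w)) ` ker_polys T"
  have fstG: "fst ` ?G = {vpoly_op p T | p. p \<in> ker_polys T}"
    by (auto simp: image_image)
  have "\<exists>E. bounded_clinear E \<and> range E \<subseteq> closure (snd ` ?G) \<and> (\<forall>(h, v)\<in>?G. E h = v)"
  proof (rule bounded_clinear_extension_of_graph)
    fix h v h' v' assume "(h, v) \<in> ?G" "(h', v') \<in> ?G"
    then obtain p q where pq: "p \<in> ker_polys T" "q \<in> ker_polys T"
      "h = vpoly_op p T" "v = vpoly p w" "h' = vpoly_op q T" "v' = vpoly q w"
      by auto
    then show "(h + h', v + v') \<in> ?G"
      by (intro image_eqI[of _ _ "p + q"])
        (simp_all add: ker_polys_add[OF T] vpoly_add vpoly_op_add[OF T])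
  next
    fix a h v assume "(h, v) \<in> ?G"
    then obtain p where "p \<in> ker_polys T" "h = vpoly_op p T" "v = vpoly p w"
      by auto
    then show "(a *\<^sub>C h, a *\<^sub>C v) \<in> ?G"
      by (intro image_eqI[of _ _ "map_poly (scaleC a) p"])
        (simp_all add: ker_polys_map_poly_scaleC[OF T] vpoly_map_poly_scaleC
          vpoly_op_map_poly_scaleC[OF T])
  next
    fix h v assume "(h, v) \<in> ?G"
    then show "norm v \<le> c * norm h"
      using c by auto
  next
    show "closure (fst ` ?G) = UNIV"
      unfolding fstG by (rule dense_vpoly_op[OF T wsp])
  qed
  then obtain E where E: "bounded_clinear E" "range E \<subseteq> closure (snd ` ?G)"
    "\<forall>p\<in>ker_polys T. E (vpoly_op p T) = vpoly p w"
    by auto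
  have "closure (snd ` ?G) \<subseteq> ker_adj T"
    using vpoly_in_ker_adj[OF T] by (intro closure_minimal closed_ker_adj T) auto
  with E(2) have E2: "range E \<subseteq> ker_adj T"
    by blast
  have "\<exists>!E. bounded_clinear E \<and> range E \<subseteq> ker_adj T \<and>
      (\<forall>p\<in>ker_polys T. E (vpoly_op p T) = vpoly p w)"
  proof (rule ex1I[of _ E])
    fix F assume F: "bounded_clinear F \<and> range F \<subseteq> ker_adj T \<and>
      (\<forall>p\<in>ker_polys T. F (vpoly_op p T) = vpoly p w)"
    have "closed {h. F h = E h}"
      using F E(1)
      by (intro closed_Collect_eq linear_continuous_on bounded_clinear_bounded_linear) auto
    then have "closure {vpoly_op p T | p. p \<in> ker_polys T} \<subseteq> {h. F h = E h}"
      using F E(3) by (intro closure_minimal) auto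
    then show "F = E"
      unfolding dense_vpoly_op[OF T wsp] by auto
  qed (use E E2 in auto)
  from theI'[OF this] show "bounded_clinear (eval_op T w)"
    "p \<in> ker_polys T \<Longrightarrow> eval_op T w (vpoly_op p T) = vpoly p w"
    unfolding eval_op_def by auto
qed

section \<open>The characterization of bounded point evaluations\<close>

lemma onorm_on_le:
  assumes "0 \<in> K" "0 \<le> b" "\<And>x. x \<in> K \<Longrightarrow> norm (A x) \<le> b * norm x"
  shows "onorm_on K A \<le> b"
  unfolding onorm_on_def
proof (rule cSUP_least)
  show "norm (A x) / norm x \<le> b" if "x \<in> K" for x
    using assms(2) assms(3)[OF that] by (cases "x = 0") (auto simp: divide_le_eq)
qed (use assms(1) in blast)

text \<open>Without the bound \<open>b\<close> the supremum in \<open>onorm_on\<close> would be an unspecified number.\<close>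

lemma
  assumes bound: "\<And>x. x \<in> K \<Longrightarrow> norm (A x) \<le> b * norm x" and A0: "A 0 = 0"
  shows norm_le_onorm_on: "x \<in> K \<Longrightarrow> norm (A x) \<le> onorm_on K A * norm x"
    and onorm_on_nonneg: "0 \<in> K \<Longrightarrow> 0 \<le> onorm_on K A"
proof -
  have "norm (A x) / norm x \<le> \<bar>b\<bar>" if "x \<in> K" for x
  proof (cases "x = 0")
    case False
    have "b * norm x \<le> \<bar>b\<bar> * norm x"
      by (intro mult_right_mono) auto
    with bound[OF that] have "norm (A x) \<le> \<bar>b\<bar> * norm x"
      by linarith
    with False show ?thesis
      by (simp add: divide_le_eq)
  qed simp
  then have bdd: "bdd_above ((\<lambda>x. norm (A x) / norm x) ` K)"
    by (intro bdd_aboveI[of _ "\<bar>b\<bar>"]) auto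
  show "norm (A x) \<le> onorm_on K A * norm x" if "x \<in> K"
    using cSUP_upper[OF that bdd] A0 unfolding onorm_on_def
    by (cases "x = 0") (auto simp: divide_le_eq)
  show "0 \<le> onorm_on K A" if "0 \<in> K"
    using cSUP_upper[OF that bdd] unfolding onorm_on_def by simp
qed

theorem theorem2p5:
  fixes T :: "'a::chilbert_space \<Rightarrow> 'a" and w :: complex
  assumes "separable_space (euclidean :: 'a topology)"
    and "bounded_clinear T"
    and "left_invertible T"
    and "wandering_subspace_property T"
  shows "(w \<in> bpe T \<longleftrightarrow>
           bdd_above (range (\<lambda>n. onorm_on (ker_adj T) (cproj (wand_space T n) \<circ> dual_sum T n w)))) \<and>
         (w \<in> bpe T \<longrightarrow>
           onorm_on (ker_adj T) (cadjoint (eval_op T w)) =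
             (SUP n. onorm_on (ker_adj T) (cproj (wand_space T n) \<circ> dual_sum T n w)))"
proof -
  note T = assms(2) and left_inv = assms(3) and wsp = assms(4)
  let ?K = "ker_adj T"
  \<comment> \<open>\<open>A n\<close> is \<open>P S\<^sub>n(w)\<close> with \<open>P\<close> the projection onto \<open>M\<^sub>n\<close>, and \<open>N\<close> below is the norm
     of \<open>E\<^sub>w\<^sup>*\<close>.\<close>
  define A where "A n = cproj (wand_space T n) \<circ> dual_sum T n w" for n
  define B where "B n = onorm_on ?K (A n)" for n
  have K0: "0 \<in> ?K"
    using subspace_ker_adj[OF T] by (rule complex_vector.subspace_0)
  have A_in: "A n y \<in> wand_space T n" for n y
    unfolding A_def o_def by (rule cproj_in[OF subspace_wand_space closed_wand_space])
  have key: "cinner (vpoly_op p T) (A n y) = cinner (vpoly p w) y"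
    if "p \<in> ker_polys T" "degree p \<le> n" "y \<in> ?K" for p n y
    unfolding A_def o_def by (rule cinner_vpoly_op_cproj_dual_sum[OF T left_inv that])
  have A_bounded: "\<exists>C. \<forall>y. norm (A n y) \<le> C * norm y" for n
  proof -
    obtain C where "\<And>x. norm (dual_sum T n w x) \<le> C * norm x"
      by (rule dual_sum_bounded[OF T left_inv]) blast
    moreover have "norm (A n y) \<le> norm (dual_sum T n w y)" for y
      unfolding A_def o_def
      by (rule norm_cproj_le[OF subspace_wand_space closed_wand_space])
    ultimately show ?thesis
      by (meson order_trans)
  qed
  have A0: "A n 0 = 0" for n
    using A_bounded[of n] by (metis mult_zero_right norm_le_zero_iff norm_zero)
  have A_le: "norm (A n y) \<le> B n * norm y" if "y \<in> ?K" for n y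
    using A_bounded[of n] that unfolding B_def by (metis norm_le_onorm_on A0)
  have B_nonneg: "0 \<le> B n" for n
    using A_bounded[of n] K0 unfolding B_def by (metis onorm_on_nonneg A0)
  \<comment> \<open>Every bound for the norms \<open>B n\<close> is a constant of the point evaluation at \<open>w\<close>: test
     the reproducing identity with \<open>y = p(w)\<close>.\<close>
  have bpe_if: "norm (vpoly p w) \<le> C * norm (vpoly_op p T)"
    if C: "\<And>n. B n \<le> C" and p: "p \<in> ker_polys T" for C p
  proof (cases "vpoly p w = 0")
    case True
    then show ?thesis
      using B_nonneg[of 0] C[of 0] by simp
  next
    case False
    let ?v = "vpoly p w" and ?n = "degree p"
    have v: "?v \<in> ?K"
      by (rule vpoly_in_ker_adj[OF T p])
    have "norm ?v * norm ?v = cmod (cinner (vpoly_op p T) (A ?n ?v))"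
      by (simp add: key p v cmod_cinner_self)
    also have "\<dots> \<le> norm (vpoly_op p T) * norm (A ?n ?v)"
      by (rule cmod_cinner_le)
    also have "\<dots> \<le> norm (vpoly_op p T) * (C * norm ?v)"
      using A_le[OF v, of ?n] mult_right_mono[OF C[of ?n], of "norm ?v"]
      by (intro mult_left_mono) auto
    finally have "norm ?v * norm ?v \<le> (C * norm (vpoly_op p T)) * norm ?v"
      by (simp add: mult_ac)
    with False show ?thesis
      by simp
  qed
  \<comment> \<open>Conversely \<open>E\<^sub>w\<^sup>* y\<close> and \<open>A n y\<close> have the same scalar products with a dense part of
     \<open>M\<^sub>n\<close>, so the latter vector is the projection of the former onto \<open>M\<^sub>n\<close>.\<close>
  have A_le_if: "norm (A n y) \<le> norm (cadjoint (eval_op T w) y)"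
    if w: "w \<in> bpe T" and y: "y \<in> ?K" for n y
  proof (rule norm_le_if_cinner_le_on_cspan)
    show "A n y \<in> closed_cspan (\<Union>k\<le>n. (T ^^ k) ` ker_adj T)"
      using A_in unfolding wand_space_def .
    fix h assume "h \<in> cspan (\<Union>k\<le>n. (T ^^ k) ` ker_adj T)"
    then obtain p where p: "h = vpoly_op p T" "p \<in> ker_polys T" "degree p \<le> n"
      unfolding cspan_wand_space_eq[OF T] by blast
    have "cinner h (A n y) = cinner h (cadjoint (eval_op T w) y)"
      by (simp add: p key y cinner_cadjoint bounded_clinear_eval_op[OF T wsp w]
          eval_op_vpoly_op[OF T wsp w])
    then show "cmod (cinner h (A n y)) \<le> norm (cadjoint (eval_op T w) y) * norm h"
      using cmod_cinner_le[of h "cadjoint (eval_op T w) y"] by (simp add: mult.commute)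
  qed simp
  define N where "N = onorm_on ?K (cadjoint (eval_op T w))"
  have N: "norm (cadjoint (eval_op T w) y) \<le> N * norm y" "0 \<le> N"
    if w: "w \<in> bpe T" and y: "y \<in> ?K" for y
  proof -
    note E = bounded_clinear_eval_op[OF T wsp w]
    obtain C where C: "\<And>y. norm (cadjoint (eval_op T w) y) \<le> C * norm y"
      by (rule norm_cadjoint_le[OF E]) blast
    show "norm (cadjoint (eval_op T w) y) \<le> N * norm y"
      unfolding N_def by (rule norm_le_onorm_on[OF C cadjoint_zero[OF E] y])
    show "0 \<le> N"
      unfolding N_def by (rule onorm_on_nonneg[OF C cadjoint_zero[OF E] K0])
  qed
  have B_le_N: "B n \<le> N" if w: "w \<in> bpe T" for n
    unfolding B_def
  proof (rule onorm_on_le[OF K0 N(2)[OF w K0]])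
    show "norm (A n y) \<le> N * norm y" if "y \<in> ?K" for y
      using A_le_if[OF w that] N(1)[OF w that] by (rule order_trans)
  qed
  \<comment> \<open>By density of the vectors \<open>p(T)\<close>, the norm of \<open>E\<^sub>w\<^sup>*\<close> is at most every constant of the
     point evaluation, hence at most every bound for the \<open>B n\<close>.\<close>
  have N_le: "N \<le> C" if w: "w \<in> bpe T" and C: "\<And>n. B n \<le> C" for C
    unfolding N_def
  proof (rule onorm_on_le[OF K0])
    show C0: "0 \<le> C"
      using B_nonneg C by (rule order_trans)
    fix y assume y: "y \<in> ?K"
    show "norm (cadjoint (eval_op T w) y) \<le> C * norm y"
    proof (rule norm_le_if_cinner_le_on_cspan)
      show "cadjoint (eval_op T w) y \<in> closed_cspan (\<Union>n. (T ^^ n) ` ker_adj T)"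
        using wsp by (simp add: wandering_subspace_property_def)
      fix h assume "h \<in> cspan (\<Union>n. (T ^^ n) ` ker_adj T)"
      then obtain p where p: "h = vpoly_op p T" "p \<in> ker_polys T"
        unfolding cspan_wandering_eq_vpoly_op[OF T] by blast
      have "cmod (cinner h (cadjoint (eval_op T w) y)) = cmod (cinner (vpoly p w) y)"
        by (simp add: p cinner_cadjoint bounded_clinear_eval_op[OF T wsp w]
            eval_op_vpoly_op[OF T wsp w])
      also have "\<dots> \<le> norm (vpoly p w) * norm y"
        by (rule cmod_cinner_le)
      also have "\<dots> \<le> (C * norm h) * norm y"
        unfolding p(1) by (intro mult_right_mono bpe_if[OF C p(2)]) simp
      finally show "cmod (cinner h (cadjoint (eval_op T w) y)) \<le> C * norm y * norm h"
        by (simp add: mult_ac)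
    qed (use C0 in simp)
  qed
  have "w \<in> bpe T \<longleftrightarrow> bdd_above (range B)"
  proof
    assume "w \<in> bpe T"
    then show "bdd_above (range B)"
      using B_le_N by (auto intro: bdd_aboveI[of _ N])
  next
    assume "bdd_above (range B)"
    then obtain C where C: "\<And>n. B n \<le> C"
      by (auto simp: bdd_above_def)
    \<comment> \<open>\<open>C\<close> may be \<open>0\<close>, whereas a constant of a point evaluation is positive.\<close>
    have "B n \<le> C + 1" for n
      using C[of n] by linarith
    moreover have "C + 1 > 0"
      using B_nonneg[of 0] C[of 0] by linarith
    ultimately show "w \<in> bpe T"
      using bpe_if[of "C + 1"] unfolding bpe_def by blast
  qed
  moreover have "N = (SUP n. B n)" if w: "w \<in> bpe T"
  proof (rule antisym)
    have "bdd_above (range B)"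
      using B_le_N[OF w] by (auto intro: bdd_aboveI[of _ N])
    then show "N \<le> (SUP n. B n)"
      by (intro N_le[OF w] cSUP_upper) auto
    show "(SUP n. B n) \<le> N"
      by (intro cSUP_least B_le_N[OF w]) auto
  qed
  ultimately show ?thesis
    unfolding N_def B_def A_def by blast
qed

end
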